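(* There exist finite groups $G$ such that the derived subgroup $G'$ is perfect, $G^{\mathrm{ab}}=G/G'\cong C_2$, and $\mathrm{Pol}_s(G)$ is large for all sufficiently large $s$.
   Context: For groups $G,H$, a map $f:G\to H$ and $g\in G$, define $\partial_g f:G\to H$ by $(\partial_g f)(x)=f(gx)f(x)^{-1}$, and put $\partial_{g_1,\ldots,g_k}f=\partial_{g_1}(\partial_{g_2}(\cdots\partial_{g_k}f))$. Universal polynomial group: for $s\ge1$, let $F_G$ be the free group on the symbols $\{x_g : g\in G\setminus\{1\}\}$, set $x_1=1$, and let $\iota:G\to F_G$, $\iota(g)=x_g$. Let $R_s(G)$ be the normal closure in $F_G$ of all elements $(\partial_{g_1,\ldots,g_{s+1}}\iota)(1)$, $g_1,\ldots,g_{s+1}\in G$. Then $\mathrm{Pol}_s(G)=F_G/R_s(G)$. A group $\Gamma$ is large if it has a finite-index subgroup $H\le\Gamma$ admitting an epimorphism onto the free group of rank two. $C_2$ is the cyclic group of order $2$. *)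

theory Defs
  imports "HOL-Algebra.Algebra"
begin

section \<open>Free groups\<close>

text \<open>
  A letter is a pair \<open>(x, b)\<close>: the generator \<open>x\<close> if \<open>b\<close> holds, and its formal inverse otherwise.
  The free group on \<open>S\<close> consists of the classes of words in these letters modulo insertion and
  deletion of subwords \<open>x x\<inverse>\<close> and \<open>x\<inverse> x\<close>.
\<close>

abbreviation group_words :: "'a set \<Rightarrow> ('a \<times> bool) list set" where
  "group_words S \<equiv> lists (S \<times> UNIV)"

inductive word_eq :: "'a set \<Rightarrow> ('a \<times> bool) list \<Rightarrow> ('a \<times> bool) list \<Rightarrow> bool" for S where
  refl: "u \<in> group_words S \<Longrightarrow> word_eq S u u"
| sym: "word_eq S u v \<Longrightarrow> word_eq S v u"
| trans: "word_eq S u v \<Longrightarrow> word_eq S v w \<Longrightarrow> word_eq S u w"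
| cancel: "u \<in> group_words S \<Longrightarrow> v \<in> group_words S \<Longrightarrow> x \<in> S \<Longrightarrow>
    word_eq S (u @ [(x, b), (x, \<not> b)] @ v) (u @ v)"

definition word_class :: "'a set \<Rightarrow> ('a \<times> bool) list \<Rightarrow> ('a \<times> bool) list set" where
  "word_class S u = {v. word_eq S u v}"

definition free_group :: "'a set \<Rightarrow> ('a \<times> bool) list set monoid" where
  "free_group S =
    \<lparr>carrier = word_class S ` group_words S,
     monoid.mult = (\<lambda>A B. \<Union>u\<in>A. \<Union>v\<in>B. word_class S (u @ v)),
     one = word_class S []\<rparr>"

definition free_gen :: "'a set \<Rightarrow> 'a \<Rightarrow> ('a \<times> bool) list set" where
  "free_gen S x = word_class S [(x, True)]"

lemma word_eq_words:
  assumes "word_eq S u v" shows "u \<in> group_words S \<and> v \<in> group_words S"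
  using assms by induction auto

lemma word_eq_append_left:
  assumes "word_eq S u v" "w \<in> group_words S" shows "word_eq S (w @ u) (w @ v)"
  using assms
proof induction
  case (cancel u v x b)
  then show ?case using word_eq.cancel[of "w @ u" S v x b] by auto
next
  case (refl u)
  then show ?case by (intro word_eq.refl) auto
next
  case (sym u v)
  then show ?case by (blast intro: word_eq.sym)
next
  case (trans u v w)
  then show ?case by (blast intro: word_eq.trans)
qed

lemma word_eq_append_right:
  assumes "word_eq S u v" "w \<in> group_words S" shows "word_eq S (u @ w) (v @ w)"
  using assms
proof induction
  case (cancel u v x b)
  then show ?case using word_eq.cancel[of u S "v @ w" x b] by auto
next
  case (refl u)
  then show ?case by (intro word_eq.refl) auto
next
  case (sym u v)
  then show ?case by (blast intro: word_eq.sym)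
next
  case (trans u v w)
  then show ?case by (blast intro: word_eq.trans)
qed

lemma word_eq_append:
  assumes "word_eq S u u'" "word_eq S v v'" shows "word_eq S (u @ v) (u' @ v')"
proof (rule word_eq.trans)
  show "word_eq S (u @ v) (u' @ v)"
    using assms word_eq_words by (blast intro: word_eq_append_right)
  show "word_eq S (u' @ v) (u' @ v')"
    using assms word_eq_words by (blast intro: word_eq_append_left)
qed

lemma word_class_eq:
  assumes "word_eq S u v" shows "word_class S u = word_class S v"
  using assms unfolding word_class_def by (blast intro: word_eq.sym word_eq.trans)

lemma free_group_mult:
  assumes "u \<in> group_words S" "v \<in> group_words S"
  shows "word_class S u \<otimes>\<^bsub>free_group S\<^esub> word_class S v = word_class S (u @ v)"
proof -
  have "word_class S (u' @ v') = word_class S (u @ v)"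
    if "u' \<in> word_class S u" "v' \<in> word_class S v" for u' v'
    using that word_class_eq[OF word_eq_append[of S u u' v v']] by (simp add: word_class_def)
  moreover have "u \<in> word_class S u" "v \<in> word_class S v"
    using assms by (simp_all add: word_class_def word_eq.refl)
  ultimately have "(\<Union>u'\<in>word_class S u. \<Union>v'\<in>word_class S v. word_class S (u' @ v')) =
      word_class S (u @ v)" by blast
  then show ?thesis by (simp add: free_group_def)
qed

definition word_inv :: "('a \<times> bool) list \<Rightarrow> ('a \<times> bool) list" where
  "word_inv u = rev (map (\<lambda>(x, b). (x, \<not> b)) u)"

lemma word_inv_words: "u \<in> group_words S \<Longrightarrow> word_inv u \<in> group_words S"
  by (auto simp: word_inv_def in_lists_conv_set)

lemma word_inv_left:
  assumes "u \<in> group_words S" shows "word_eq S (word_inv u @ u) []"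
  using assms
proof (induction u)
  case Nil
  then show ?case by (simp add: word_inv_def word_eq.refl)
next
  case (Cons a u)
  obtain x b where a: "a = (x, b)" by fastforce
  have "word_eq S (word_inv u @ [(x, \<not> b), (x, \<not> \<not> b)] @ u) (word_inv u @ u)"
  proof (rule word_eq.cancel)
    show "word_inv u \<in> group_words S" using Cons.hyps by (intro word_inv_words)
  qed (use Cons.hyps a in auto)
  moreover have "word_eq S (word_inv u @ u) []" by (rule Cons.IH)
  moreover have "word_inv (a # u) @ a # u = word_inv u @ [(x, \<not> b), (x, \<not> \<not> b)] @ u"
    by (simp add: a word_inv_def)
  ultimately show ?case by (metis word_eq.trans)
qed

lemma group_free_group: "group (free_group S)"
proof (rule groupI)
  have carr: "carrier (free_group S) = word_class S ` group_words S"
    and one: "\<one>\<^bsub>free_group S\<^esub> = word_class S []" by (auto simp: free_group_def)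
  show "\<one>\<^bsub>free_group S\<^esub> \<in> carrier (free_group S)" by (auto simp: carr one)
  fix A assume A: "A \<in> carrier (free_group S)"
  then obtain u where u: "u \<in> group_words S" "A = word_class S u" by (auto simp: carr)
  show "\<one>\<^bsub>free_group S\<^esub> \<otimes>\<^bsub>free_group S\<^esub> A = A"
    using u free_group_mult[of "[]" S u] by (simp add: one)
  have "word_class S (word_inv u) \<otimes>\<^bsub>free_group S\<^esub> A = \<one>\<^bsub>free_group S\<^esub>"
    using u free_group_mult[of "word_inv u" S u] word_inv_words[of u S]
      word_class_eq[OF word_inv_left[of u S]] by (simp add: one)
  then show "\<exists>B\<in>carrier (free_group S). B \<otimes>\<^bsub>free_group S\<^esub> A = \<one>\<^bsub>free_group S\<^esub>"
    using word_inv_words[OF u(1)] by (auto simp: carr)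
  fix B assume "B \<in> carrier (free_group S)"
  then obtain v where v: "v \<in> group_words S" "B = word_class S v" by (auto simp: carr)
  show "A \<otimes>\<^bsub>free_group S\<^esub> B \<in> carrier (free_group S)"
    using u v free_group_mult[of u S v] by (auto simp: carr)
  fix C assume "C \<in> carrier (free_group S)"
  then obtain w where w: "w \<in> group_words S" "C = word_class S w" by (auto simp: carr)
  show "A \<otimes>\<^bsub>free_group S\<^esub> B \<otimes>\<^bsub>free_group S\<^esub> C = A \<otimes>\<^bsub>free_group S\<^esub> (B \<otimes>\<^bsub>free_group S\<^esub> C)"
    using u v w free_group_mult[of "u @ v" S w] free_group_mult[of u S "v @ w"]
    by (simp add: free_group_mult)
qed

lemma free_gen_closed: "x \<in> S \<Longrightarrow> free_gen S x \<in> carrier (free_group S)"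
  by (auto simp: free_gen_def free_group_def)

fun word_eval :: "('b, 'c) monoid_scheme \<Rightarrow> ('a \<Rightarrow> 'b) \<Rightarrow> ('a \<times> bool) list \<Rightarrow> 'b" where
  "word_eval H f [] = \<one>\<^bsub>H\<^esub>"
| "word_eval H f ((x, b) # u) = (if b then f x else inv\<^bsub>H\<^esub> (f x)) \<otimes>\<^bsub>H\<^esub> word_eval H f u"

context
  fixes H :: "('b, 'c) monoid_scheme" (structure) and S :: "'a set" and f :: "'a \<Rightarrow> 'b"
  assumes H: "group H" and f: "f ` S \<subseteq> carrier H"
begin

interpretation group H by (fact H)

lemma word_eval_closed: "u \<in> group_words S \<Longrightarrow> word_eval H f u \<in> carrier H"
  using f by (induction u) auto

lemma word_eval_append:
  "u \<in> group_words S \<Longrightarrow> v \<in> group_words S \<Longrightarrow>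
    word_eval H f (u @ v) = word_eval H f u \<otimes> word_eval H f v"
proof (induction u)
  case (Cons a u)
  have "word_eval H f u \<in> carrier H" "word_eval H f v \<in> carrier H"
    using Cons.prems by (auto intro!: word_eval_closed)
  then show ?case using Cons f by (cases a) (auto simp: m_assoc)
next
  case Nil
  then show ?case using word_eval_closed[of v] by simp
qed

lemma word_eval_cong: "word_eq S u v \<Longrightarrow> word_eval H f u = word_eval H f v"
proof (induction rule: word_eq.induct)
  case (cancel u v x b)
  have fx: "f x \<in> carrier H" using cancel f by auto
  have "word_eval H f ([(x, b), (x, \<not> b)] @ v) = word_eval H f v"
    using fx word_eval_closed[OF cancel(2)] by (auto simp: m_assoc[symmetric])
  moreover have "[(x, b), (x, \<not> b)] @ v \<in> group_words S" using cancel by auto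
  ultimately show ?case using cancel by (simp only: word_eval_append)
qed auto

lemma free_group_universal:
  shows "\<exists>h\<in>hom (free_group S) H. \<forall>x\<in>S. h (free_gen S x) = f x"
    and "\<lbrakk>h \<in> hom (free_group S) H; h' \<in> hom (free_group S) H;
          \<And>x. x \<in> S \<Longrightarrow> h (free_gen S x) = h' (free_gen S x); A \<in> carrier (free_group S)\<rbrakk>
         \<Longrightarrow> h A = h' A"
proof -
  define h where "h A = word_eval H f (SOME u. u \<in> A)" for A
  have h: "h (word_class S u) = word_eval H f u" if "u \<in> group_words S" for u
  proof -
    have "u \<in> word_class S u" using that by (simp add: word_class_def word_eq.refl)
    then have "(SOME v. v \<in> word_class S u) \<in> word_class S u" by (rule someI)
    then have "word_eq S u (SOME v. v \<in> word_class S u)" by (simp add: word_class_def)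
    then show ?thesis unfolding h_def by (rule word_eval_cong[symmetric])
  qed
  have "h \<in> hom (free_group S) H"
  proof (rule homI)
    fix A B assume "A \<in> carrier (free_group S)" "B \<in> carrier (free_group S)"
    then obtain u v where uv: "u \<in> group_words S" "A = word_class S u"
      "v \<in> group_words S" "B = word_class S v" by (auto simp: free_group_def)
    then show "h (A \<otimes>\<^bsub>free_group S\<^esub> B) = h A \<otimes> h B"
      using h[of "u @ v"] by (simp add: free_group_mult h word_eval_append)
  next
    fix A assume "A \<in> carrier (free_group S)"
    then obtain u where "u \<in> group_words S" "A = word_class S u" by (auto simp: free_group_def)
    then show "h A \<in> carrier H" by (simp only: h word_eval_closed)
  qed
  moreover have "h (free_gen S x) = f x" if "x \<in> S" for x
    using that f h[of "[(x, True)]"] by (auto simp: free_gen_def)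
  ultimately show "\<exists>h\<in>hom (free_group S) H. \<forall>x\<in>S. h (free_gen S x) = f x" by blast
next
  fix h h' A
  assume hom: "h \<in> hom (free_group S) H" "h' \<in> hom (free_group S) H"
    and gen: "\<And>x. x \<in> S \<Longrightarrow> h (free_gen S x) = h' (free_gen S x)"
    and A: "A \<in> carrier (free_group S)"
  interpret F: group "free_group S" by (rule group_free_group)
  interpret h: group_hom "free_group S" H h using hom by unfold_locales
  interpret h': group_hom "free_group S" H h' using hom by unfold_locales
  have inv: "word_class S [(x, False)] = inv\<^bsub>free_group S\<^esub> free_gen S x" if "x \<in> S" for x
  proof (rule F.inv_equality[symmetric])
    have "word_class S [(x, False), (x, True)] = word_class S []"
      using word_eq.cancel[of "[]" S "[]" x False] that by (intro word_class_eq) simp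
    then show "word_class S [(x, False)] \<otimes>\<^bsub>free_group S\<^esub> free_gen S x = \<one>\<^bsub>free_group S\<^esub>"
      using that by (simp add: free_gen_def free_group_mult) (simp add: free_group_def)
  qed (use that in \<open>auto simp: free_gen_def free_group_def\<close>)
  have "h (word_class S u) = h' (word_class S u)" if "u \<in> group_words S" for u
    using that
  proof (induction u)
    case Nil
    have "word_class S [] = \<one>\<^bsub>free_group S\<^esub>" by (simp add: free_group_def)
    then show ?case by simp
  next
    case (Cons a u)
    obtain x b where a: "a = (x, b)" by fastforce
    have x: "x \<in> S" and u: "u \<in> group_words S" using Cons.hyps a by auto
    have "h (word_class S [a]) = h' (word_class S [a])"
      using gen[OF x] inv[OF x] free_gen_closed[OF x]
      by (cases b) (simp_all add: a flip: free_gen_def)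
    moreover have "word_class S (a # u) = word_class S [a] \<otimes>\<^bsub>free_group S\<^esub> word_class S u"
      using free_group_mult[of "[a]" S u] x u a by simp
    moreover have "word_class S [a] \<in> carrier (free_group S)" "word_class S u \<in> carrier (free_group S)"
      using x u a by (auto simp: free_group_def)
    ultimately show ?case using Cons.IH by simp
  qed
  then show "h A = h' A" using A by (auto simp: free_group_def)
qed

end

section \<open>Normal closures\<close>

definition normal_closure :: "('a, 'b) monoid_scheme \<Rightarrow> 'a set \<Rightarrow> 'a set" where
  "normal_closure G A = \<Inter>{N. N \<lhd> G \<and> A \<subseteq> N}"

lemma (in group) normal_closure_normal:
  assumes "A \<subseteq> carrier G" shows "normal_closure G A \<lhd> G"
proof -
  have "carrier G \<lhd> G" by (simp add: normal_inv_iff subgroup_self)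
  then have ne: "{N. N \<lhd> G \<and> A \<subseteq> N} \<noteq> {}" using assms by blast
  then have "subgroup (normal_closure G A) G"
    unfolding normal_closure_def by (intro subgroups_Inter) (auto dest: normal_imp_subgroup)
  then show ?thesis
    by (auto simp: normal_inv_iff normal_closure_def)
qed

section \<open>Polynomial maps and the universal polynomial groups\<close>

definition group_diff ::
  "('a, 'c) monoid_scheme \<Rightarrow> ('b, 'd) monoid_scheme \<Rightarrow> 'a \<Rightarrow> ('a \<Rightarrow> 'b) \<Rightarrow> 'a \<Rightarrow> 'b" where
  "group_diff G H g f = (\<lambda>x. f (g \<otimes>\<^bsub>G\<^esub> x) \<otimes>\<^bsub>H\<^esub> inv\<^bsub>H\<^esub> (f x))"

text \<open>For \<open>gs = [g\<^sub>1, \<dots>, g\<^sub>k]\<close> the last entry \<open>g\<^sub>k\<close> is applied first.\<close>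

definition group_diffs ::
  "('a, 'c) monoid_scheme \<Rightarrow> ('b, 'd) monoid_scheme \<Rightarrow> 'a list \<Rightarrow> ('a \<Rightarrow> 'b) \<Rightarrow> 'a \<Rightarrow> 'b" where
  "group_diffs G H gs f = foldr (group_diff G H) gs f"

definition pol_free :: "('a, 'c) monoid_scheme \<Rightarrow> ('a \<times> bool) list set monoid" where
  "pol_free G = free_group (carrier G - {\<one>\<^bsub>G\<^esub>})"

definition pol_iota :: "('a, 'c) monoid_scheme \<Rightarrow> 'a \<Rightarrow> ('a \<times> bool) list set" where
  "pol_iota G g =
    (if g = \<one>\<^bsub>G\<^esub> then \<one>\<^bsub>pol_free G\<^esub> else free_gen (carrier G - {\<one>\<^bsub>G\<^esub>}) g)"

definition pol_relators :: "nat \<Rightarrow> ('a, 'c) monoid_scheme \<Rightarrow> ('a \<times> bool) list set set" where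
  "pol_relators s G =
    {group_diffs G (pol_free G) gs (pol_iota G) \<one>\<^bsub>G\<^esub> | gs. set gs \<subseteq> carrier G \<and> length gs = s + 1}"

definition Pol :: "nat \<Rightarrow> ('a, 'c) monoid_scheme \<Rightarrow> ('a \<times> bool) list set set monoid" where
  "Pol s G = pol_free G Mod normal_closure (pol_free G) (pol_relators s G)"

lemma group_Pol:
  assumes "group G" shows "group (Pol s G)"
proof -
  interpret G: group G by (fact assms)
  interpret F: group "pol_free G" unfolding pol_free_def by (rule group_free_group)
  have iota: "pol_iota G g \<in> carrier (pol_free G)" if "g \<in> carrier G" for g
    using that free_gen_closed[of g "carrier G - {\<one>\<^bsub>G\<^esub>}"] F.one_closed
    by (auto simp: pol_iota_def pol_free_def)
  have "group_diffs G (pol_free G) gs (pol_iota G) x \<in> carrier (pol_free G)"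
    if "set gs \<subseteq> carrier G" "x \<in> carrier G" for gs x
    using that
    by (induction gs arbitrary: x) (auto simp: group_diffs_def group_diff_def iota)
  then have "pol_relators s G \<subseteq> carrier (pol_free G)"
    by (auto simp: pol_relators_def)
  then show ?thesis
    unfolding Pol_def by (intro normal.factorgroup_is_group F.normal_closure_normal)
qed

section \<open>Perfect and large groups\<close>

definition perfect_group :: "('a, 'b) monoid_scheme \<Rightarrow> bool" where
  "perfect_group G \<longleftrightarrow> group G \<and> derived G (carrier G) = carrier G"

text \<open>
  Finite index is finiteness of the set of right cosets; \<open>card\<close> would not do, being 0 for an
  infinite set.
\<close>

definition large_group :: "('a, 'b) monoid_scheme \<Rightarrow> bool" where
  "large_group \<Gamma> \<longleftrightarrow> group \<Gamma> \<and>
    (\<exists>H. subgroup H \<Gamma> \<and> finite (rcosets\<^bsub>\<Gamma>\<^esub> H) \<and>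
      epi (\<Gamma>\<lparr>carrier := H\<rparr>) (free_group {0::nat, 1}) \<noteq> {})"

end

theory Submission
  imports Defs
begin

text \<open>
  Let \<open>\<epsilon>\<close> be the parity homomorphism on \<open>G = S\<^sub>5\<close>, and let \<open>Y\<close> map \<open>G\<close> to involutions of a group \<open>A\<close>
  whose pairwise products have order dividing 4. Let \<open>\<phi>(x)\<close> act on \<open>G \<times> A\<close> by sending the fibre
  over \<open>h\<close> to the fibre over \<open>x h\<close>, twisted by \<open>Y(x h)\<close> if \<open>x\<close> is odd. Then \<open>\<partial>\<^sub>g \<phi>\<close> depends only on
  parity. For a map with value \<open>a\<close> on even and \<open>b\<close> on odd elements, each further difference
  replaces \<open>c = b a\<inverse>\<close> by \<open>c\<^sup>-\<^sup>2\<close> or \<open>1\<close>; since \<open>c\<^sup>4 = 1\<close> here, \<open>\<phi>\<close> is polynomial of degree at most 3.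

  If \<open>Y(1) = 1\<close> and \<open>Y\<close> attains all its values on odd elements, the stabiliser of the fibre over 1
  maps onto the group generated by the values of \<open>Y\<close>. These can generate a large group: extend the
  free group by an involution inverting its two generators. The involutions of the extension
  generate a large group, but their products have infinite order; this is cured by placing them at
  different positions of a wreath product with the Klein four-group, where they commute, and
  adding the Klein four-group itself to the generators.
\<close>

section \<open>Iterated differences of maps that depend only on parity\<close>

section \<open>Polynomial maps\<close>

text \<open>The group of order two on truth values, so that a parity homomorphism is a predicate. As
  its carrier is all of \<open>bool\<close>, functions on it need no restriction.\<close>

definition xor_group :: "bool monoid" where
  "xor_group = \<lparr>carrier = UNIV, monoid.mult = (\<noteq>), one = False\<rparr>"

lemma xor_group_simps [simp]:
  "carrier xor_group = UNIV" "x \<otimes>\<^bsub>xor_group\<^esub> y = (x \<noteq> y)" "\<one>\<^bsub>xor_group\<^esub> = False"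
  by (simp_all add: xor_group_def)

lemma group_xor_group: "group xor_group"
  by (rule groupI) auto

lemma group_diffs_one:
  assumes "group G" "group H" "set gs \<subseteq> carrier G" "\<And>x. x \<in> carrier G \<Longrightarrow> f x = \<one>\<^bsub>H\<^esub>"
    "x \<in> carrier G"
  shows "group_diffs G H gs f x = \<one>\<^bsub>H\<^esub>"
proof -
  interpret G: group G by fact
  interpret H: group H by fact
  show ?thesis
    using assms(3,5)
    by (induction gs arbitrary: x) (auto simp: group_diffs_def group_diff_def assms(4))
qed

text \<open>Put c = b a^-1. The difference by an odd g has the value c on even and c^-1 on odd
  elements, so the new quotient is c^-2 and \<open>j\<close> drops by one. The difference by an even
  g is trivial. Hence j + 1 differences suffice. The induction removes the last entry of the list
  because that entry is applied first.\<close>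

lemma group_diffs_two_valued:
  assumes "group G" "group H" and eps: "\<epsilon> \<in> hom G xor_group"
    and "a \<in> carrier H" "b \<in> carrier H"
    and "\<And>x. x \<in> carrier G \<Longrightarrow> f x = (if \<epsilon> x then b else a)"
    and "(b \<otimes>\<^bsub>H\<^esub> inv\<^bsub>H\<^esub> a) [^]\<^bsub>H\<^esub> (2 ^ j :: nat) = \<one>\<^bsub>H\<^esub>"
    and "set gs \<subseteq> carrier G" "j < length gs" "x \<in> carrier G"
  shows "group_diffs G H gs f x = \<one>\<^bsub>H\<^esub>"
proof -
  interpret G: group G by fact
  interpret H: group H by fact
  show ?thesis
    using assms(4-)
  proof (induction gs arbitrary: f a b j rule: rev_induct)
    case (snoc g gs)
    define c where "c = b \<otimes>\<^bsub>H\<^esub> inv\<^bsub>H\<^esub> a"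
    let ?f = "group_diff G H g f"
    have c: "c \<in> carrier H" using snoc.prems by (simp add: c_def)
    have ic: "inv\<^bsub>H\<^esub> c = a \<otimes>\<^bsub>H\<^esub> inv\<^bsub>H\<^esub> b"
      using snoc.prems by (simp add: c_def H.inv_mult_group)
    have g: "g \<in> carrier G" and gs: "set gs \<subseteq> carrier G" using snoc.prems by auto
    have step: "group_diffs G H (gs @ [g]) f x = group_diffs G H gs ?f x"
      by (simp add: group_diffs_def)
    have eg: "\<epsilon> (g \<otimes>\<^bsub>G\<^esub> y) \<longleftrightarrow> \<epsilon> g \<noteq> \<epsilon> y" if "y \<in> carrier G" for y
      using hom_mult[OF eps g that] by simp
    have f': "?f y = (if \<epsilon> g then (if \<epsilon> y then inv\<^bsub>H\<^esub> c else c) else \<one>\<^bsub>H\<^esub>)" if "y \<in> carrier G" for y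
      using that g snoc.prems(1-3) eg[OF that] ic by (auto simp: group_diff_def c_def)
    show ?case
    \<comment> \<open>In the first case the difference is trivial at once: either g is even, or j =
      0 and c = 1.\<close>
    proof (cases "\<epsilon> g \<and> j \<noteq> 0")
      case False
      have "?f y = \<one>\<^bsub>H\<^esub>" if "y \<in> carrier G" for y
        using False f'[OF that] snoc.prems(4) c by (auto simp: c_def[symmetric])
      then show ?thesis
        unfolding step using gs snoc.prems(7) assms(1,2) by (intro group_diffs_one)
    next
      case True
      then obtain i where j: "j = Suc i" by (cases j) auto
      show ?thesis unfolding step
      \<comment> \<open>The hypothesis is used with c in the role of \<open>a\<close>, its inverse
        in the role of \<open>b\<close>, and \<open>i\<close> in the role of
        \<open>j\<close>.\<close>
      proof (rule snoc.IH)
        show "(inv\<^bsub>H\<^esub> c \<otimes>\<^bsub>H\<^esub> inv\<^bsub>H\<^esub> c) [^]\<^bsub>H\<^esub> (2 ^ i :: nat) = \<one>\<^bsub>H\<^esub>"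
        proof -
          have "inv\<^bsub>H\<^esub> c \<otimes>\<^bsub>H\<^esub> inv\<^bsub>H\<^esub> c = (inv\<^bsub>H\<^esub> c) [^]\<^bsub>H\<^esub> (2 :: nat)"
            using c by (simp add: numeral_2_eq_2)
          then have "(inv\<^bsub>H\<^esub> c \<otimes>\<^bsub>H\<^esub> inv\<^bsub>H\<^esub> c) [^]\<^bsub>H\<^esub> (2 ^ i :: nat) = (inv\<^bsub>H\<^esub> c) [^]\<^bsub>H\<^esub> (2 ^ j :: nat)"
            using c by (simp add: H.nat_pow_pow j)
          then show ?thesis using c snoc.prems(4) by (simp add: H.nat_pow_inv c_def[symmetric])
        qed
      qed (use True f' c gs snoc.prems j in auto)
    qed
  qed simp
qed

section \<open>The universal property of the polynomial groups\<close>

lemma hom_group_diffs: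
  assumes "group G" "group K" "group H" "h \<in> hom K H" "\<And>x. x \<in> carrier G \<Longrightarrow> f x \<in> carrier K"
    "set gs \<subseteq> carrier G" "x \<in> carrier G"
  shows "group_diffs G K gs f x \<in> carrier K \<and>
    h (group_diffs G K gs f x) = group_diffs G H gs (h \<circ> f) x"
proof -
  interpret G: group G by fact
  interpret h: group_hom K H h using assms by (simp add: group_hom_def group_hom_axioms_def)
  show ?thesis
    using assms(6,7)
    by (induction gs arbitrary: x) (auto simp: group_diffs_def group_diff_def assms(5))
qed

text \<open>The extension of \<open>\<phi>\<close> to the free group commutes with differences, so
  it kills the relators and factors through the quotient. The relators are differences evaluated at
  1, which is why \<open>poly\<close> is a condition at 1 alone.\<close>

lemma Pol_universal:
  assumes "group G" "group H" and phi: "\<phi> \<in> carrier G \<rightarrow> carrier H" "\<phi> \<one>\<^bsub>G\<^esub> = \<one>\<^bsub>H\<^esub>"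
    and poly: "\<And>gs. set gs \<subseteq> carrier G \<Longrightarrow> length gs = s + 1 \<Longrightarrow> group_diffs G H gs \<phi> \<one>\<^bsub>G\<^esub> = \<one>\<^bsub>H\<^esub>"
  shows "\<exists>h\<in>hom (Pol s G) H. \<phi> ` carrier G \<subseteq> h ` carrier (Pol s G)"
proof -
  let ?F = "pol_free G" and ?S = "carrier G - {\<one>\<^bsub>G\<^esub>}"
  interpret G: group G by fact
  interpret H: group H by fact
  interpret F: group ?F unfolding pol_free_def by (rule group_free_group)
  obtain h where h: "h \<in> hom ?F H" and hgen: "\<And>x. x \<in> ?S \<Longrightarrow> h (free_gen ?S x) = \<phi> x"
    using free_group_universal(1)[OF \<open>group H\<close>, of \<phi> ?S] phi unfolding pol_free_def by blast
  interpret h: group_hom ?F H h using h by unfold_locales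
  have iota: "pol_iota G g \<in> carrier ?F" if "g \<in> carrier G" for g
    using that free_gen_closed[of g ?S] F.one_closed by (auto simp: pol_iota_def pol_free_def)
  have hiota: "h (pol_iota G g) = \<phi> g" if "g \<in> carrier G" for g
    using that phi hgen[of g] by (auto simp: pol_iota_def)
  have rel: "r \<in> carrier ?F \<and> h r = \<one>\<^bsub>H\<^esub>" if r: "r \<in> pol_relators s G" for r
  proof -
    obtain gs where gs: "set gs \<subseteq> carrier G" "length gs = s + 1"
      "r = group_diffs G ?F gs (pol_iota G) \<one>\<^bsub>G\<^esub>" using r by (auto simp: pol_relators_def)
    \<comment> \<open>The two maps agree on the carrier, and differences at a point of the carrier
      evaluate them nowhere else.\<close>
    have "group_diffs G H gs (h \<circ> pol_iota G) x = group_diffs G H gs \<phi> x" if "x \<in> carrier G" for x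
      using gs(1) that
      by (induction gs arbitrary: x) (auto simp: group_diffs_def group_diff_def hiota)
    then show ?thesis
      using hom_group_diffs[OF assms(1) F.is_group assms(2) h iota gs(1) G.one_closed] poly[OF gs(1,2)] gs(3)
      by simp
  qed
  let ?N = "normal_closure ?F (pol_relators s G)"
  have "?N \<lhd> ?F" using rel by (intro F.normal_closure_normal) auto
  moreover have "?N \<subseteq> kernel ?F H h"
    using rel h.normal_kernel unfolding normal_closure_def by (intro Inter_lower) (auto simp: kernel_def)
  ultimately obtain k where k: "k \<in> hom (?F Mod ?N) H"
    "\<And>x. x \<in> carrier ?F \<Longrightarrow> k (?N #>\<^bsub>?F\<^esub> x) = h x"
    using h.FactGroup_universal_kernel by blast
  have "\<phi> g \<in> k ` carrier (Pol s G)" if "g \<in> carrier G" for g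
    using that k(2)[OF iota] hiota iota
    by (auto simp: Pol_def FactGroup_def RCOSETS_def intro!: image_eqI[of _ _ "?N #>\<^bsub>?F\<^esub> pol_iota G g"])
  then show ?thesis using k(1) by (auto simp: Pol_def)
qed

section \<open>Wreath products acting on fibres\<close>

section \<open>Regular wreath products\<close>

text \<open>A pair (x, c) stands for the map on Q x A that sends the fibre over h to the fibre over
  x h by left multiplication with c h; the product is composition. Extensional functions turn
  equality on the carrier of Q into plain equality.\<close>

definition wreath :: "('a, 'c) monoid_scheme \<Rightarrow> ('q, 'd) monoid_scheme \<Rightarrow> ('q \<times> ('q \<Rightarrow> 'a)) monoid" where
  "wreath A Q =
    \<lparr>carrier = carrier Q \<times> (carrier Q \<rightarrow>\<^sub>E carrier A),
     monoid.mult = (\<lambda>(x, c) (y, d). (x \<otimes>\<^bsub>Q\<^esub> y, \<lambda>h\<in>carrier Q. c (y \<otimes>\<^bsub>Q\<^esub> h) \<otimes>\<^bsub>A\<^esub> d h)),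
     one = (\<one>\<^bsub>Q\<^esub>, \<lambda>h\<in>carrier Q. \<one>\<^bsub>A\<^esub>)\<rparr>"

lemma wreath_simps:
  "carrier (wreath A Q) = carrier Q \<times> (carrier Q \<rightarrow>\<^sub>E carrier A)"
  "(x, c) \<otimes>\<^bsub>wreath A Q\<^esub> (y, d) = (x \<otimes>\<^bsub>Q\<^esub> y, \<lambda>h\<in>carrier Q. c (y \<otimes>\<^bsub>Q\<^esub> h) \<otimes>\<^bsub>A\<^esub> d h)"
  "\<one>\<^bsub>wreath A Q\<^esub> = (\<one>\<^bsub>Q\<^esub>, \<lambda>h\<in>carrier Q. \<one>\<^bsub>A\<^esub>)"
  by (simp_all add: wreath_def)

lemma group_wreath:
  assumes "group A" "group Q"
  shows "group (wreath A Q)"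
proof -
  interpret A: group A by fact
  interpret Q: group Q by fact
  show ?thesis
  proof (rule groupI)
    fix x assume x: "x \<in> carrier (wreath A Q)"
    then obtain q c where qc: "x = (q, c)" "q \<in> carrier Q" "c \<in> carrier Q \<rightarrow>\<^sub>E carrier A"
      by (auto simp: wreath_simps)
    have c: "c h \<in> carrier A" if "h \<in> carrier Q" for h using that qc by auto
    show "\<exists>y\<in>carrier (wreath A Q). y \<otimes>\<^bsub>wreath A Q\<^esub> x = \<one>\<^bsub>wreath A Q\<^esub>"
    proof (rule bexI)
      \<comment> \<open>The inverse leads from the fibre over h back to the fibre over q^-1 h, so it
        undoes the twist that \<open>c\<close> has there.\<close>
      show "(inv\<^bsub>Q\<^esub> q, \<lambda>h\<in>carrier Q. inv\<^bsub>A\<^esub> c (inv\<^bsub>Q\<^esub> q \<otimes>\<^bsub>Q\<^esub> h)) \<otimes>\<^bsub>wreath A Q\<^esub> x = \<one>\<^bsub>wreath A Q\<^esub>"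
        using qc c by (auto simp: wreath_simps Q.m_assoc[symmetric] fun_eq_iff restrict_def)
    qed (use qc c in \<open>auto simp: wreath_simps\<close>)
    show "\<one>\<^bsub>wreath A Q\<^esub> \<otimes>\<^bsub>wreath A Q\<^esub> x = x"
      using qc c by (auto simp: wreath_simps fun_eq_iff restrict_def PiE_def extensional_def)
  qed (auto simp: wreath_simps fun_eq_iff restrict_def A.m_assoc Q.m_assoc PiE_iff extensional_def)
qed

lemma wreath_base_pow:
  assumes "group A" "group Q" "c \<in> carrier Q \<rightarrow>\<^sub>E carrier A"
  shows "(\<one>\<^bsub>Q\<^esub>, c) [^]\<^bsub>wreath A Q\<^esub> (n :: nat) = (\<one>\<^bsub>Q\<^esub>, \<lambda>h\<in>carrier Q. c h [^]\<^bsub>A\<^esub> n)"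
proof -
  interpret A: group A by fact
  interpret Q: group Q by fact
  show ?thesis
    by (induction n) (auto simp: wreath_simps nat_pow_def fun_eq_iff restrict_def)
qed


text \<open>The first difference applied, by the last entry of \<open>gs\<close>, has one value on
  even and one on odd elements. Their quotient is a base element whose coordinates are products of
  two values of \<open>Y\<close>, so j + 1 further differences suffice.\<close>

lemma wreath_group_diffs:
  assumes "group A" "group G" and eps: "\<epsilon> \<in> hom G xor_group"
    and Y: "\<And>h. h \<in> carrier G \<Longrightarrow> Y h \<in> carrier A \<and> Y h \<otimes>\<^bsub>A\<^esub> Y h = \<one>\<^bsub>A\<^esub>"
    and YY: "\<And>h k. h \<in> carrier G \<Longrightarrow> k \<in> carrier G \<Longrightarrow> (Y h \<otimes>\<^bsub>A\<^esub> Y k) [^]\<^bsub>A\<^esub> (2 ^ j :: nat) = \<one>\<^bsub>A\<^esub>"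
    and phi: "\<phi> = (\<lambda>x. (x, \<lambda>h\<in>carrier G. if \<epsilon> x then Y (x \<otimes>\<^bsub>G\<^esub> h) else \<one>\<^bsub>A\<^esub>))"
    and gs: "set gs \<subseteq> carrier G" "Suc j < length gs" "x \<in> carrier G"
  shows "group_diffs G (wreath A G) gs \<phi> x = \<one>\<^bsub>wreath A G\<^esub>"
proof -
  interpret A: group A by fact
  interpret G: group G by fact
  interpret W: group "wreath A G" using assms by (intro group_wreath)
  obtain g gs' where gs': "gs = gs' @ [g]" using gs by (cases gs rule: rev_cases) auto
  then have g: "g \<in> carrier G" using gs by auto
  have e: "\<epsilon> (x \<otimes>\<^bsub>G\<^esub> y) \<longleftrightarrow> \<epsilon> x \<noteq> \<epsilon> y" if "x \<in> carrier G" "y \<in> carrier G" for x y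
    using hom_mult[OF eps that] by simp
  \<comment> \<open>The values of \<open>\<partial>\<^sub>g \<phi>\<close> on even and on odd elements; their quotient lies in the base group.\<close>
  define a where "a = (g, \<lambda>h\<in>carrier G. if \<epsilon> g then Y (g \<otimes>\<^bsub>G\<^esub> h) else \<one>\<^bsub>A\<^esub>)"
  define b where "b = (g, \<lambda>h\<in>carrier G. (if \<epsilon> g then \<one>\<^bsub>A\<^esub> else Y (g \<otimes>\<^bsub>G\<^esub> h)) \<otimes>\<^bsub>A\<^esub> Y h)"
  define u where "u = (\<lambda>k\<in>carrier G. let l = inv\<^bsub>G\<^esub> g \<otimes>\<^bsub>G\<^esub> k in
    if \<epsilon> g then Y l \<otimes>\<^bsub>A\<^esub> Y k else Y k \<otimes>\<^bsub>A\<^esub> Y l)"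
  have u: "u \<in> carrier G \<rightarrow>\<^sub>E carrier A" using Y g by (auto simp: u_def Let_def)
  have ab: "a \<in> carrier (wreath A G)" "b \<in> carrier (wreath A G)"
    using Y g by (auto simp: a_def b_def wreath_simps)
  have uc: "(\<one>\<^bsub>G\<^esub>, u) \<in> carrier (wreath A G)" using u by (simp add: wreath_simps)
  \<comment> \<open>Compared at the coordinate h, which reads \<open>u\<close> at k = g h; the
    element l in the definition of \<open>u\<close> is then h itself.\<close>
  have "b = (\<one>\<^bsub>G\<^esub>, u) \<otimes>\<^bsub>wreath A G\<^esub> a"
    using Y g by (auto simp: a_def b_def u_def wreath_simps fun_eq_iff restrict_def Let_def
      G.m_assoc[symmetric] A.m_assoc)
  then have ba: "b \<otimes>\<^bsub>wreath A G\<^esub> inv\<^bsub>wreath A G\<^esub> a = (\<one>\<^bsub>G\<^esub>, u)"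
    using ab uc by (simp add: W.m_assoc)
  have "(\<one>\<^bsub>G\<^esub>, u) [^]\<^bsub>wreath A G\<^esub> (2 ^ j :: nat) = \<one>\<^bsub>wreath A G\<^esub>"
    using YY g by (simp add: wreath_base_pow[OF assms(1,2) u])
      (auto simp: u_def wreath_simps fun_eq_iff restrict_def Let_def)
  moreover have "group_diff G (wreath A G) g \<phi> x = (if \<epsilon> x then b else a)" if x: "x \<in> carrier G" for x
  proof -
    have c: "\<phi> y \<in> carrier (wreath A G)" if "y \<in> carrier G" for y
      using Y that by (auto simp: phi wreath_simps)
    \<comment> \<open>For odd x the last factor of \<open>b\<close> meets the twist Y (x h) of
      \<open>\<phi> x\<close>, and the two cancel because values of \<open>Y\<close> have square
      1.\<close>
    have "\<phi> (g \<otimes>\<^bsub>G\<^esub> x) = (if \<epsilon> x then b else a) \<otimes>\<^bsub>wreath A G\<^esub> \<phi> x"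
      using Y g x by (auto simp: phi a_def b_def wreath_simps fun_eq_iff restrict_def e
        G.m_assoc A.m_assoc)
    then show ?thesis using ab c[OF x] by (simp add: group_diff_def W.m_assoc)
  qed
  ultimately have "group_diffs G (wreath A G) gs' (group_diff G (wreath A G) g \<phi>) x = \<one>\<^bsub>wreath A G\<^esub>"
    using gs gs' ab ba by (intro group_diffs_two_valued[OF assms(2) W.is_group eps]) auto
  then show ?thesis by (simp add: gs' group_diffs_def)
qed

section \<open>Descent along finite-index subgroups\<close>

section \<open>Images of finite-index subgroups\<close>

text \<open>Only containment of \<open>Z\<close> in the image is recorded, so a tower of groups can
  be descended by exhibiting elements, without determining any image exactly.\<close>

definition virtual_image ::
  "('a, 'c) monoid_scheme \<Rightarrow> ('b, 'd) monoid_scheme \<Rightarrow> 'b set \<Rightarrow> bool" where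
  "virtual_image \<Gamma> A Z \<longleftrightarrow> (\<exists>H f. subgroup H \<Gamma> \<and> finite (rcosets\<^bsub>\<Gamma>\<^esub> H) \<and>
    f \<in> hom (\<Gamma>\<lparr>carrier := H\<rparr>) A \<and> Z \<subseteq> f ` H)"

text \<open>Choose a representative r of each coset H x. Modulo \<open>K\<close>, the element x is
  determined by H x together with p (x r^-1), and this pair takes finitely many values.\<close>

lemma (in group) finite_rcosets_of_finite_fibres:
  assumes "subgroup H G" "finite (rcosets H)" "subgroup K G" "finite (p ` H)"
    and p: "\<And>x y. x \<in> H \<Longrightarrow> y \<in> H \<Longrightarrow> p x = p y \<Longrightarrow> x \<otimes> inv y \<in> K"
  shows "finite (rcosets K)"
proof -
  define r where "r x = (SOME y. y \<in> H #> x)" for x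
  define P where "P x = (H #> x, p (x \<otimes> inv (r x)))" for x
  have r: "r x \<in> carrier G" "x \<otimes> inv (r x) \<in> H" if x: "x \<in> carrier G" for x
  proof -
    have *: "r x \<in> H #> x" unfolding r_def using rcos_self[OF x assms(1)] by (rule someI)
    then show "r x \<in> carrier G"
      using x r_coset_subset_G subgroup.subset[OF assms(1)] by blast
    then have "r x \<otimes> inv x \<in> H"
      using x * subgroup.rcos_module_imp[OF assms(1) is_group] by blast
    then have "inv (r x \<otimes> inv x) \<in> H" using assms(1) subgroup.m_inv_closed by metis
    then show "x \<otimes> inv (r x) \<in> H" using x \<open>r x \<in> carrier G\<close> by (simp add: inv_mult_group)
  qed
  have "K #> x = K #> y" if x: "x \<in> carrier G" and y: "y \<in> carrier G" and "P x = P y" for x y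
  proof -
    \<comment> \<open>The representative is chosen from the coset as a set, so equal cosets share
      it.\<close>
    have eq: "r x = r y" "p (x \<otimes> inv (r x)) = p (y \<otimes> inv (r x))"
      using \<open>P x = P y\<close> by (auto simp: P_def r_def)
    then have "(x \<otimes> inv (r x)) \<otimes> inv (y \<otimes> inv (r x)) \<in> K"
      using p r(2)[OF x] r(2)[OF y] by metis
    moreover have "(x \<otimes> inv (r x)) \<otimes> inv (y \<otimes> inv (r x)) = x \<otimes> inv y"
      using x y r(1)[OF x] by (simp add: inv_mult_group m_assoc inv_solve_left')
    ultimately have "x \<in> K #> y"
      using subgroup.rcos_module_rev[OF assms(3) is_group y x] by simp
    then show ?thesis using repr_independence[OF _ y assms(3)] by simp
  qed
  then obtain k where k: "\<And>x. x \<in> carrier G \<Longrightarrow> K #> x = k (P x)"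
    using function_factors_left_gen[of "\<lambda>x. x \<in> carrier G" P "\<lambda>x. K #> x"] by blast
  have "P ` carrier G \<subseteq> (rcosets H) \<times> (p ` H)" using r by (auto simp: P_def RCOSETS_def)
  then have "finite (P ` carrier G)" using assms(2,4) finite_subset by blast
  moreover have "rcosets K \<subseteq> k ` P ` carrier G" using k by (auto simp: RCOSETS_def)
  ultimately show ?thesis by (blast intro: finite_subset)
qed

lemma virtual_image_generate:
  assumes "group \<Gamma>" "group A" "virtual_image \<Gamma> A Z"
  shows "virtual_image \<Gamma> A (generate A Z)"
proof -
  obtain H f where H: "subgroup H \<Gamma>" "finite (rcosets\<^bsub>\<Gamma>\<^esub> H)" "f \<in> hom (\<Gamma>\<lparr>carrier := H\<rparr>) A" "Z \<subseteq> f ` H"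
    using assms by (auto simp: virtual_image_def)
  interpret f: group_hom "\<Gamma>\<lparr>carrier := H\<rparr>" A f
    using assms H group.subgroup_imp_group by (auto simp: group_hom_def group_hom_axioms_def)
  have "subgroup (f ` H) A" using f.img_is_subgroup by simp
  then show ?thesis using H f.H.generate_subgroup_incl unfolding virtual_image_def by blast
qed

text \<open>The elements of \<open>H\<close> mapped into the base group form the kernel of a
  homomorphism to the finite group \<open>Q\<close>, so they have finite index in
  \<open>\<Gamma>\<close>. On the base group, evaluation at the coordinate 1 is a homomorphism to
  \<open>A\<close>.\<close>

lemma virtual_image_wreath:
  assumes "group \<Gamma>" "group A" "group Q" "finite (carrier Q)" and Z: "virtual_image \<Gamma> (wreath A Q) Z"
  shows "virtual_image \<Gamma> A {c \<one>\<^bsub>Q\<^esub> | c. (\<one>\<^bsub>Q\<^esub>, c) \<in> generate (wreath A Q) Z}"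
proof -
  interpret \<Gamma>: group \<Gamma> by fact
  interpret A: group A by fact
  interpret Q: group Q by fact
  interpret W: group "wreath A Q" using assms by (intro group_wreath)
  obtain H f where H: "subgroup H \<Gamma>" "finite (rcosets\<^bsub>\<Gamma>\<^esub> H)" "f \<in> hom (\<Gamma>\<lparr>carrier := H\<rparr>) (wreath A Q)"
    "generate (wreath A Q) Z \<subseteq> f ` H"
    using virtual_image_generate[OF assms(1) W.is_group Z] by (auto simp: virtual_image_def)
  interpret H: subgroup H \<Gamma> by fact
  interpret f: group_hom "\<Gamma>\<lparr>carrier := H\<rparr>" "wreath A Q" f
    using H \<Gamma>.subgroup_imp_group by (auto simp: group_hom_def group_hom_axioms_def)
  have fst_hom: "fst \<in> hom (wreath A Q) Q" by (rule homI) (auto simp: wreath_simps)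
  interpret q: group_hom "\<Gamma>\<lparr>carrier := H\<rparr>" Q "fst \<circ> f"
    using hom_compose[OF f.homh fst_hom] by unfold_locales
  define K where "K = kernel (\<Gamma>\<lparr>carrier := H\<rparr>) Q (fst \<circ> f)"
  have KH: "K \<subseteq> H" and KD: "x \<in> K \<longleftrightarrow> x \<in> H \<and> fst (f x) = \<one>\<^bsub>Q\<^esub>" for x
    by (auto simp: K_def kernel_def)
  have "subgroup K (\<Gamma>\<lparr>carrier := H\<rparr>)" unfolding K_def by (rule q.subgroup_kernel)
  then have K: "subgroup K \<Gamma>" using \<Gamma>.incl_subgroup H(1) by blast
  have "finite (rcosets\<^bsub>\<Gamma>\<^esub> K)"
  proof (rule \<Gamma>.finite_rcosets_of_finite_fibres[OF H(1,2) K])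
    show "finite ((fst \<circ> f) ` H)" using q.hom_closed assms(4) by (auto intro: finite_subset)
    fix x y assume xy: "x \<in> H" "y \<in> H" "(fst \<circ> f) x = (fst \<circ> f) y"
    then have "(fst \<circ> f) (x \<otimes>\<^bsub>\<Gamma>\<^esub> inv\<^bsub>\<Gamma>\<^esub> y) = \<one>\<^bsub>Q\<^esub>"
      using q.hom_mult[of x "inv\<^bsub>\<Gamma>\<^esub> y"] q.hom_inv[of y] q.hom_closed[of y] H(1)
      by (simp add: \<Gamma>.m_inv_consistent)
    then show "x \<otimes>\<^bsub>\<Gamma>\<^esub> inv\<^bsub>\<Gamma>\<^esub> y \<in> K" using xy by (simp add: KD)
  qed
  moreover have "(\<lambda>x. snd (f x) \<one>\<^bsub>Q\<^esub>) \<in> hom (\<Gamma>\<lparr>carrier := K\<rparr>) A"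
  proof (rule homI)
    fix x assume "x \<in> carrier (\<Gamma>\<lparr>carrier := K\<rparr>)"
    then show "snd (f x) \<one>\<^bsub>Q\<^esub> \<in> carrier A"
      using f.hom_closed[of x] by (auto simp: KD wreath_simps)
  next
    fix x y assume "x \<in> carrier (\<Gamma>\<lparr>carrier := K\<rparr>)" "y \<in> carrier (\<Gamma>\<lparr>carrier := K\<rparr>)"
    then have xy: "x \<in> H" "fst (f x) = \<one>\<^bsub>Q\<^esub>" "y \<in> H" "fst (f y) = \<one>\<^bsub>Q\<^esub>" by (auto simp: KD)
    then have "f x = (\<one>\<^bsub>Q\<^esub>, snd (f x))" "f y = (\<one>\<^bsub>Q\<^esub>, snd (f y))" by (simp_all add: prod_eq_iff)
    then have "f (x \<otimes>\<^bsub>\<Gamma>\<^esub> y) = (\<one>\<^bsub>Q\<^esub>, snd (f x)) \<otimes>\<^bsub>wreath A Q\<^esub> (\<one>\<^bsub>Q\<^esub>, snd (f y))"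
      using f.hom_mult[of x y] xy by simp
    then show "snd (f (x \<otimes>\<^bsub>\<Gamma>\<lparr>carrier := K\<rparr>\<^esub> y)) \<one>\<^bsub>Q\<^esub> = snd (f x) \<one>\<^bsub>Q\<^esub> \<otimes>\<^bsub>A\<^esub> snd (f y) \<one>\<^bsub>Q\<^esub>"
      by (simp add: wreath_simps)
  qed
  moreover have "{c \<one>\<^bsub>Q\<^esub> | c. (\<one>\<^bsub>Q\<^esub>, c) \<in> generate (wreath A Q) Z} \<subseteq> (\<lambda>x. snd (f x) \<one>\<^bsub>Q\<^esub>) ` K"
  proof clarify
    fix c assume "(\<one>\<^bsub>Q\<^esub>, c) \<in> generate (wreath A Q) Z"
    then obtain x where "x \<in> H" "f x = (\<one>\<^bsub>Q\<^esub>, c)" using H(4) by (metis imageE subsetD)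
    then show "c \<one>\<^bsub>Q\<^esub> \<in> (\<lambda>x. snd (f x) \<one>\<^bsub>Q\<^esub>) ` K" by (auto simp: KD intro!: image_eqI[of _ _ x])
  qed
  ultimately show ?thesis using K unfolding virtual_image_def by blast
qed

lemma virtual_image_mono: "virtual_image \<Gamma> A Z \<Longrightarrow> Z' \<subseteq> Z \<Longrightarrow> virtual_image \<Gamma> A Z'"
  unfolding virtual_image_def by blast

lemma virtual_image_wreathI:
  assumes "group \<Gamma>" "group A" "group Q" "finite (carrier Q)" "virtual_image \<Gamma> (wreath A Q) Z"
    "\<And>x. x \<in> Z' \<Longrightarrow> x \<in> {c \<one>\<^bsub>Q\<^esub> | c. (\<one>\<^bsub>Q\<^esub>, c) \<in> generate (wreath A Q) Z}"
  shows "virtual_image \<Gamma> A Z'"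
  by (rule virtual_image_mono[OF virtual_image_wreath[OF assms(1-5)]]) (use assms(6) in blast)

section \<open>From free generators in the image to an epimorphism\<close>

lemma subgroup_free_group_eq:
  assumes K: "subgroup K (free_group S)" and gen: "free_gen S ` S \<subseteq> K"
  shows "K = carrier (free_group S)"
proof -
  interpret F: group "free_group S" by (rule group_free_group)
  interpret K: subgroup K "free_group S" by fact
  have letter: "word_class S [(x, b)] \<in> K" if x: "x \<in> S" for x b
  proof (cases b)
    case True
    then show ?thesis using gen x by (auto simp: free_gen_def)
  next
    case False
    have "word_class S [(x, False)] = inv\<^bsub>free_group S\<^esub> free_gen S x"
    proof (rule F.inv_equality[symmetric])
      show "word_class S [(x, False)] \<otimes>\<^bsub>free_group S\<^esub> free_gen S x = \<one>\<^bsub>free_group S\<^esub>"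
        using x word_class_eq[OF word_inv_left[of "[(x, True)]" S]]
        by (simp add: free_gen_def free_group_mult word_inv_def) (simp add: free_group_def)
    qed (use x in \<open>auto simp: free_gen_def free_group_def\<close>)
    then show ?thesis using False gen x by auto
  qed
  have "word_class S u \<in> K" if "u \<in> group_words S" for u
    using that
  proof (induction u)
    case Nil
    then show ?case using K.one_closed by (simp add: free_group_def)
  next
    case (Cons a u)
    then show ?case
      using K.m_closed[OF letter[of "fst a" "snd a"] Cons.IH] free_group_mult[of "[a]" S u]
      by (auto simp: mem_Times_iff)
  qed
  then show ?thesis using K.subset by (auto simp: free_group_def)
qed

lemma large_group_of_virtual_image:
  assumes "group \<Gamma>" "virtual_image \<Gamma> (free_group {0::nat, 1}) (free_gen {0, 1} ` {0, 1})"
  shows "large_group \<Gamma>"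
proof -
  let ?F = "free_group {0::nat, 1}"
  obtain H f where H: "subgroup H \<Gamma>" "finite (rcosets\<^bsub>\<Gamma>\<^esub> H)" "f \<in> hom (\<Gamma>\<lparr>carrier := H\<rparr>) ?F"
    "free_gen {0, 1} ` {0, 1} \<subseteq> f ` H"
    using assms(2) unfolding virtual_image_def by blast
  interpret f: group_hom "\<Gamma>\<lparr>carrier := H\<rparr>" ?F f
    by (intro group_hom.intro group_hom_axioms.intro group_free_group H(3)
        group.subgroup_imp_group[OF assms(1) H(1)])
  have "f ` H = carrier ?F" using subgroup_free_group_eq[OF _ H(4)] f.img_is_subgroup by simp
  then have "f \<in> epi (\<Gamma>\<lparr>carrier := H\<rparr>) ?F" using H(3) by (simp add: epi_def)
  then show ?thesis using assms(1) H(1,2) unfolding large_group_def by blast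
qed


section \<open>Involutions whose pairwise products have order dividing 4\<close>

section \<open>Involutions in a wreath product\<close>

definition shift :: "('a, 'c) monoid_scheme \<Rightarrow> ('q, 'd) monoid_scheme \<Rightarrow> 'q \<Rightarrow> 'q \<times> ('q \<Rightarrow> 'a)" where
  "shift A Q q = (q, \<lambda>h\<in>carrier Q. \<one>\<^bsub>A\<^esub>)"

definition single ::
  "('a, 'c) monoid_scheme \<Rightarrow> ('q, 'd) monoid_scheme \<Rightarrow> 'q \<Rightarrow> 'a \<Rightarrow> 'q \<times> ('q \<Rightarrow> 'a)" where
  "single A Q p v = (\<one>\<^bsub>Q\<^esub>, \<lambda>h\<in>carrier Q. if h = p then v else \<one>\<^bsub>A\<^esub>)"

text \<open>Two shifts multiply to a shift. Two single entries commute or coincide, so their product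
  has square 1. A shift times a single entry has as its square either 1 or a product of entries at
  two different positions, which is again of square 1; the opposite order gives the inverse of such
  a product.\<close>

lemma shift_single_relations:
  assumes "group A" "group Q" and exp2: "\<And>q. q \<in> carrier Q \<Longrightarrow> q \<otimes>\<^bsub>Q\<^esub> q = \<one>\<^bsub>Q\<^esub>"
    and v: "\<And>q. q \<in> carrier Q \<Longrightarrow> v q \<in> carrier A \<and> v q \<otimes>\<^bsub>A\<^esub> v q = \<one>\<^bsub>A\<^esub>"
    and S: "S = shift A Q ` carrier Q \<union> (\<lambda>p. single A Q p (v p)) ` carrier Q"
    and "y \<in> S" "z \<in> S"
  shows "y \<in> carrier (wreath A Q)" "y \<otimes>\<^bsub>wreath A Q\<^esub> y = \<one>\<^bsub>wreath A Q\<^esub>"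
    "(y \<otimes>\<^bsub>wreath A Q\<^esub> z) [^]\<^bsub>wreath A Q\<^esub> (4 :: nat) = \<one>\<^bsub>wreath A Q\<^esub>"
proof -
  interpret A: group A by fact
  interpret Q: group Q by fact
  interpret W: group "wreath A Q" using assms by (intro group_wreath)
  have carr: "y \<in> carrier (wreath A Q)" and sq: "y \<otimes>\<^bsub>wreath A Q\<^esub> y = \<one>\<^bsub>wreath A Q\<^esub>" if "y \<in> S" for y
    using that v exp2 by (auto simp: S shift_def single_def wreath_simps fun_eq_iff restrict_def)
  then show "y \<in> carrier (wreath A Q)" "y \<otimes>\<^bsub>wreath A Q\<^esub> y = \<one>\<^bsub>wreath A Q\<^esub>" using \<open>y \<in> S\<close> by auto
  have pow4: "w [^]\<^bsub>wreath A Q\<^esub> (4 :: nat) = \<one>\<^bsub>wreath A Q\<^esub>"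
    if "w \<in> carrier (wreath A Q)" "w \<otimes>\<^bsub>wreath A Q\<^esub> w = w'" "w' \<otimes>\<^bsub>wreath A Q\<^esub> w' = \<one>\<^bsub>wreath A Q\<^esub>" for w w'
  proof -
    have "w [^]\<^bsub>wreath A Q\<^esub> (4 :: nat) = w [^]\<^bsub>wreath A Q\<^esub> (2 :: nat) \<otimes>\<^bsub>wreath A Q\<^esub> w [^]\<^bsub>wreath A Q\<^esub> (2 :: nat)"
      using that by (simp add: W.nat_pow_mult)
    moreover have "w [^]\<^bsub>wreath A Q\<^esub> (2 :: nat) = w'" using that by (simp add: numeral_2_eq_2)
    ultimately show ?thesis using that by simp
  qed
  have mixed: "(shift A Q q \<otimes>\<^bsub>wreath A Q\<^esub> single A Q p (v p)) [^]\<^bsub>wreath A Q\<^esub> (4 :: nat) = \<one>\<^bsub>wreath A Q\<^esub>"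
    if qp: "q \<in> carrier Q" "p \<in> carrier Q" for q p
  proof (rule pow4[OF _ HOL.refl])
    \<comment> \<open>A nontrivial q moves every position, so the two entries in the square never
      meet.\<close>
    have "q \<otimes>\<^bsub>Q\<^esub> h = h \<longleftrightarrow> q = \<one>\<^bsub>Q\<^esub>" if "h \<in> carrier Q" for h using qp that by simp
    then show "(shift A Q q \<otimes>\<^bsub>wreath A Q\<^esub> single A Q p (v p)) \<otimes>\<^bsub>wreath A Q\<^esub>
      (shift A Q q \<otimes>\<^bsub>wreath A Q\<^esub> single A Q p (v p)) \<otimes>\<^bsub>wreath A Q\<^esub>
      ((shift A Q q \<otimes>\<^bsub>wreath A Q\<^esub> single A Q p (v p)) \<otimes>\<^bsub>wreath A Q\<^esub>
      (shift A Q q \<otimes>\<^bsub>wreath A Q\<^esub> single A Q p (v p))) = \<one>\<^bsub>wreath A Q\<^esub>"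
      using qp v exp2 by (auto simp: shift_def single_def wreath_simps fun_eq_iff restrict_def)
    have "shift A Q q \<in> S" "single A Q p (v p) \<in> S" using qp by (auto simp: S)
    then show "shift A Q q \<otimes>\<^bsub>wreath A Q\<^esub> single A Q p (v p) \<in> carrier (wreath A Q)"
      by (intro W.m_closed carr)
  qed
  consider (shift) q r where "q \<in> carrier Q" "r \<in> carrier Q" "y = shift A Q q" "z = shift A Q r"
    | (shift_single) q p where "q \<in> carrier Q" "p \<in> carrier Q" "y = shift A Q q" "z = single A Q p (v p)"
    | (single_shift) q p where "q \<in> carrier Q" "p \<in> carrier Q" "z = shift A Q q" "y = single A Q p (v p)"
    | (single) p r where "p \<in> carrier Q" "r \<in> carrier Q" "y = single A Q p (v p)" "z = single A Q r (v r)"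
  proof -
    have "(\<exists>q\<in>carrier Q. x = shift A Q q) \<or> (\<exists>p\<in>carrier Q. x = single A Q p (v p))" if "x \<in> S" for x
      using that by (auto simp: S)
    from this[OF assms(6)] this[OF assms(7)] show thesis
      using that by (elim disjE bexE)
  qed
  then show "(y \<otimes>\<^bsub>wreath A Q\<^esub> z) [^]\<^bsub>wreath A Q\<^esub> (4 :: nat) = \<one>\<^bsub>wreath A Q\<^esub>"
  proof cases
    case shift
    then have "y \<otimes>\<^bsub>wreath A Q\<^esub> z \<in> S"
      unfolding S by (intro UnI1 image_eqI[of _ _ "q \<otimes>\<^bsub>Q\<^esub> r"])
        (auto simp: shift_def wreath_simps fun_eq_iff restrict_def)
    then show ?thesis using pow4[OF carr sq] by simp
  next
    case shift_single
    then show ?thesis using mixed by simp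
  next
    case single_shift
    have yz: "y \<in> carrier (wreath A Q)" "z \<in> carrier (wreath A Q)" using assms carr by auto
    have "inv\<^bsub>wreath A Q\<^esub> y = y" "inv\<^bsub>wreath A Q\<^esub> z = z"
      using W.inv_equality[OF sq[OF assms(6)] yz(1,1)] W.inv_equality[OF sq[OF assms(7)] yz(2,2)] by auto
    then have "y \<otimes>\<^bsub>wreath A Q\<^esub> z = inv\<^bsub>wreath A Q\<^esub> (z \<otimes>\<^bsub>wreath A Q\<^esub> y)"
      using yz by (simp add: W.inv_mult_group)
    then show ?thesis using mixed single_shift yz by (simp add: W.nat_pow_inv)
  next
    case single
    \<comment> \<open>For p = r the only possible entry is v p times itself, which is 1; otherwise
      each coordinate receives at most one nontrivial factor.\<close>
    define u where "u = (\<lambda>h\<in>carrier Q. (if h = p then v p else \<one>\<^bsub>A\<^esub>) \<otimes>\<^bsub>A\<^esub> (if h = r then v r else \<one>\<^bsub>A\<^esub>))"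
    have u: "u h \<in> carrier A \<and> u h \<otimes>\<^bsub>A\<^esub> u h = \<one>\<^bsub>A\<^esub>" if "h \<in> carrier Q" for h
      using v single(1,2) that by (cases "h = p"; cases "h = r") (auto simp: u_def)
    then have "u h [^]\<^bsub>A\<^esub> (4 :: nat) = \<one>\<^bsub>A\<^esub>" if "h \<in> carrier Q" for h
      using u[OF that] by (simp add: numeral_eq_Suc)
    moreover have "u \<in> carrier Q \<rightarrow>\<^sub>E carrier A" using u by (auto simp: u_def)
    moreover have "y \<otimes>\<^bsub>wreath A Q\<^esub> z = (\<one>\<^bsub>Q\<^esub>, u)"
      using single by (auto simp: single_def u_def wreath_simps fun_eq_iff restrict_def)
    ultimately show ?thesis
      by (simp add: wreath_base_pow[OF assms(1,2)] wreath_simps cong: restrict_cong)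
  qed
qed

section \<open>From an odd-valued twist to a free quotient\<close>

section \<open>Largeness\<close>

text \<open>An involution for every \<open>x\<close>; the product of two of them has infinite order in general.\<close>

definition flip :: "('a, 'c) monoid_scheme \<Rightarrow> 'a \<Rightarrow> bool \<times> (bool \<Rightarrow> 'a)" where
  "flip F x = (True, \<lambda>e. if e then x else inv\<^bsub>F\<^esub> x)"

text \<open>The bound 8 leaves room for four shifts and four single entries as values of
  \<open>Y\<close> on odd elements. The bound on \<open>s\<close> is the degree that products of
  order dividing 4 allow.\<close>

lemma large_group_Pol:
  fixes G :: "('a, 'c) monoid_scheme"
  assumes "group G" "finite (carrier G)" and eps: "\<epsilon> \<in> hom G xor_group"
    and odd: "8 \<le> card {x \<in> carrier G. \<epsilon> x}" and s: "3 \<le> s"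
  shows "large_group (Pol s G)"
proof -
  \<comment> \<open>Keeps the simplifier from rewriting the generating set {0, 1} with
    \<open>Suc 0\<close>.\<close>
  note One_nat_def [simp del]
  let ?F = "free_group {0::nat, 1}"
  let ?V = "wreath ?F xor_group"
  let ?Q = "xor_group \<times>\<times> xor_group"
  let ?W = "wreath ?V ?Q"
  let ?P = "Pol s G"
  interpret G: group G by fact
  interpret F: group ?F by (rule group_free_group)
  interpret V: group ?V by (intro group_wreath F.is_group group_xor_group)
  have Q: "group ?Q" by (intro DirProd_group group_xor_group)
  interpret W: group ?W by (intro group_wreath V.is_group Q)
  interpret WG: group "wreath ?W G" by (intro group_wreath W.is_group G.is_group)
  interpret P: group ?P using assms(1) by (rule group_Pol)
  have Qs: "carrier ?Q = UNIV" "\<one>\<^bsub>?Q\<^esub> = (False, False)" by (auto simp: DirProd_def)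
  have finQ: "finite (carrier ?Q)" and finX: "finite (carrier xor_group)" by (simp_all add: Qs)
  have Qm: "x \<otimes>\<^bsub>?Q\<^esub> y = (fst x \<noteq> fst y, snd x \<noteq> snd y)" for x y
    by (auto simp: DirProd_def split_def)
  have e: "\<epsilon> (x \<otimes>\<^bsub>G\<^esub> y) \<longleftrightarrow> \<epsilon> x \<noteq> \<epsilon> y" if "x \<in> carrier G" "y \<in> carrier G" for x y
    using hom_mult[OF eps that] by simp
  have e1: "\<not> \<epsilon> \<one>\<^bsub>G\<^esub>" using e[of "\<one>\<^bsub>G\<^esub>" "\<one>\<^bsub>G\<^esub>"] by simp

  \<comment> \<open>The three elements needed are the two free generators and 1, whose flip is the
    plain swap. The Klein four-group has four positions, so one generator occurs twice.\<close>
  define f where "f p = (if p = (False, False) then \<one>\<^bsub>?F\<^esub> else if p = (False, True) then free_gen {0, 1} 0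
    else free_gen {0, 1} 1)" for p
  have f: "f p \<in> carrier ?F" for p by (auto simp: f_def free_gen_closed)
  define v where "v p = flip ?F (f p)" for p
  have v: "v p \<in> carrier ?V \<and> v p \<otimes>\<^bsub>?V\<^esub> v p = \<one>\<^bsub>?V\<^esub>" for p
    using f[of p] by (auto simp: v_def flip_def wreath_simps fun_eq_iff)
  define S where "S = shift ?V ?Q ` carrier ?Q \<union> (\<lambda>p. single ?V ?Q p (v p)) ` carrier ?Q"
  have rel: "y \<in> carrier ?W" "y \<otimes>\<^bsub>?W\<^esub> y = \<one>\<^bsub>?W\<^esub>" "(y \<otimes>\<^bsub>?W\<^esub> z) [^]\<^bsub>?W\<^esub> (4 :: nat) = \<one>\<^bsub>?W\<^esub>"
    if "y \<in> S" "z \<in> S" for y z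
    using shift_single_relations[OF V.is_group Q _ _ S_def that] v by (auto simp: Qs Qm)
  have one_S: "\<one>\<^bsub>?W\<^esub> \<in> S"
    unfolding S_def by (intro UnI1 image_eqI[of _ _ "\<one>\<^bsub>?Q\<^esub>"]) (auto simp: shift_def wreath_simps Qs)
  have "finite S" by (simp add: S_def Qs)
  have "card S \<le> card (shift ?V ?Q ` carrier ?Q) + card ((\<lambda>p. single ?V ?Q p (v p)) ` carrier ?Q)"
    unfolding S_def by (rule card_Un_le)
  also have "\<dots> \<le> card (carrier ?Q) + card (carrier ?Q)"
    by (intro add_mono card_image_le) (simp_all add: Qs)
  also have "\<dots> = 8" by (simp add: Qs card_UNIV_bool flip: UNIV_Times_UNIV)
  finally obtain i where i: "i ` S \<subseteq> {x \<in> carrier G. \<epsilon> x}" "inj_on i S"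
    using card_le_inj[OF \<open>finite S\<close>, of "{x \<in> carrier G. \<epsilon> x}"] odd assms(2) by auto
  \<comment> \<open>The default 1 belongs to \<open>S\<close>, so the relations cover it. It is also
    the value at the identity of G, which is even and thus not hit by \<open>i\<close>.\<close>
  define Y where "Y h = (if h \<in> i ` S then the_inv_into S i h else \<one>\<^bsub>?W\<^esub>)" for h
  have Y: "Y h \<in> S" for h
    using one_S the_inv_into_into[OF i(2)] by (auto simp: Y_def)
  have Yi: "Y (i y) = y" if "y \<in> S" for y using that by (simp add: Y_def the_inv_into_f_f[OF i(2)])
  have Y1: "Y \<one>\<^bsub>G\<^esub> = \<one>\<^bsub>?W\<^esub>" using i(1) e1 by (auto simp: Y_def)

  define \<phi> where "\<phi> = (\<lambda>x. (x, \<lambda>h\<in>carrier G. if \<epsilon> x then Y (x \<otimes>\<^bsub>G\<^esub> h) else \<one>\<^bsub>?W\<^esub>))"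
  have "\<exists>h\<in>hom ?P (wreath ?W G). \<phi> ` carrier G \<subseteq> h ` carrier ?P"
  proof (rule Pol_universal[OF assms(1) WG.is_group])
    show "\<phi> \<in> carrier G \<rightarrow> carrier (wreath ?W G)"
      using Y rel(1)[OF Y Y] by (auto simp: \<phi>_def wreath_simps(1)[of ?W])
    show "\<phi> \<one>\<^bsub>G\<^esub> = \<one>\<^bsub>wreath ?W G\<^esub>" using e1 by (simp add: \<phi>_def wreath_simps(3)[of ?W])
    \<comment> \<open>Here j = 2, since 4 = 2^2, and at least four differences are taken because s
      is at least 3.\<close>
    show "group_diffs G (wreath ?W G) gs \<phi> \<one>\<^bsub>G\<^esub> = \<one>\<^bsub>wreath ?W G\<^esub>"
      if "set gs \<subseteq> carrier G" "length gs = s + 1" for gs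
      using that s rel[OF Y Y]
      by (intro wreath_group_diffs[OF W.is_group assms(1) eps _ _ \<phi>_def, where j = 2]) auto
  qed
  moreover have "finite (rcosets\<^bsub>?P\<^esub> carrier ?P)"
  proof -
    have "rcosets\<^bsub>?P\<^esub> carrier ?P \<subseteq> {carrier ?P}"
      using P.subgroup_self by (auto simp: RCOSETS_def P.coset_join2)
    then show ?thesis by (rule finite_subset) simp
  qed
  ultimately have "virtual_image ?P (wreath ?W G) (\<phi> ` carrier G)"
    using P.subgroup_self unfolding virtual_image_def by (intro exI[of _ "carrier ?P"]) auto
  then have "virtual_image ?P ?W S"
  proof (rule virtual_image_wreathI[OF P.is_group W.is_group G.is_group assms(2)])
    fix y assume "y \<in> S"
    define t where "t = i y"
    have t: "t \<in> carrier G" "\<epsilon> t" "Y t = y" using i(1) \<open>y \<in> S\<close> Yi by (auto simp: t_def)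
    have "\<epsilon> (inv\<^bsub>G\<^esub> t)" using e[of "inv\<^bsub>G\<^esub> t" t] e1 t by simp
    \<comment> \<open>This base element has at the coordinate 1 the entry Y 1 times Y t, which is
      y.\<close>
    then have "\<phi> (inv\<^bsub>G\<^esub> t) \<otimes>\<^bsub>wreath ?W G\<^esub> \<phi> t =
        (\<one>\<^bsub>G\<^esub>, \<lambda>h\<in>carrier G. Y h \<otimes>\<^bsub>?W\<^esub> Y (t \<otimes>\<^bsub>G\<^esub> h))"
      using t by (auto simp: \<phi>_def wreath_simps(2)[of ?W] fun_eq_iff restrict_def G.m_assoc[symmetric])
    moreover have "\<phi> (inv\<^bsub>G\<^esub> t) \<otimes>\<^bsub>wreath ?W G\<^esub> \<phi> t \<in> generate (wreath ?W G) (\<phi> ` carrier G)"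
      using t by (intro generate.eng generate.incl) auto
    ultimately show "y \<in> {c \<one>\<^bsub>G\<^esub> | c. (\<one>\<^bsub>G\<^esub>, c) \<in> generate (wreath ?W G) (\<phi> ` carrier G)}"
      using t Y1 rel(1)[OF \<open>y \<in> S\<close> \<open>y \<in> S\<close>]
      by (intro CollectI exI[of _ "\<lambda>h\<in>carrier G. Y h \<otimes>\<^bsub>?W\<^esub> Y (t \<otimes>\<^bsub>G\<^esub> h)"]) auto
  qed
  then have "virtual_image ?P ?V (range v)"
  proof (rule virtual_image_wreathI[OF P.is_group V.is_group Q finQ])
    fix x assume "x \<in> range v"
    then obtain p where p: "x = v p" by blast
    \<comment> \<open>Conjugation by the shift p carries the entry from position p to the identity
      position, where it can be read off.\<close>
    have "shift ?V ?Q p \<otimes>\<^bsub>?W\<^esub> single ?V ?Q p (v p) \<otimes>\<^bsub>?W\<^esub> shift ?V ?Q p =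
        (\<one>\<^bsub>?Q\<^esub>, \<lambda>h\<in>carrier ?Q. if p \<otimes>\<^bsub>?Q\<^esub> h = p then v p else \<one>\<^bsub>?V\<^esub>)"
      using v[of p] by (auto simp: shift_def single_def wreath_simps(2)[of ?V] Qs Qm fun_eq_iff)
    moreover have "shift ?V ?Q p \<otimes>\<^bsub>?W\<^esub> single ?V ?Q p (v p) \<otimes>\<^bsub>?W\<^esub> shift ?V ?Q p \<in> generate ?W S"
      by (intro generate.eng generate.incl) (auto simp: S_def Qs)
    ultimately show "x \<in> {c \<one>\<^bsub>?Q\<^esub> | c. (\<one>\<^bsub>?Q\<^esub>, c) \<in> generate ?W S}"
      using p by (intro CollectI exI[of _ "\<lambda>h\<in>carrier ?Q. if p \<otimes>\<^bsub>?Q\<^esub> h = p then v p else \<one>\<^bsub>?V\<^esub>"])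
        (auto simp: Qs Qm)
  qed
  then have "virtual_image ?P ?F (range f)"
  proof (rule virtual_image_wreathI[OF P.is_group F.is_group group_xor_group finX])
    fix x assume "x \<in> range f"
    then obtain p where p: "x = f p" by blast
    \<comment> \<open>Multiplying by the swap cancels the top component and leaves a base element
      with f p at the coordinate \<open>False\<close>, the identity of
      \<open>xor_group\<close>.\<close>
    have "v p \<otimes>\<^bsub>?V\<^esub> v (False, False) = (False, \<lambda>h. if h then inv\<^bsub>?F\<^esub> f p else f p)"
      using f[of p] by (auto simp: v_def flip_def f_def[of "(False, False)"] wreath_simps fun_eq_iff)
    moreover have "v p \<otimes>\<^bsub>?V\<^esub> v (False, False) \<in> generate ?V (range v)"
      by (intro generate.eng generate.incl) auto
    ultimately show "x \<in> {c \<one>\<^bsub>xor_group\<^esub> | c. (\<one>\<^bsub>xor_group\<^esub>, c) \<in> generate ?V (range v)}"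
      using p by (intro CollectI exI[of _ "\<lambda>h. if h then inv\<^bsub>?F\<^esub> f p else f p"]) auto
  qed
  then have "virtual_image ?P ?F (free_gen {0, 1} ` {0, 1})"
    by (rule virtual_image_mono) (auto simp: f_def intro: range_eqI[of _ _ "(False, True)"] range_eqI[of _ _ "(True, True)"])
  then show ?thesis by (rule large_group_of_virtual_image[OF P.is_group])
qed

section \<open>The symmetric group on five points\<close>

section \<open>A symmetric group\<close>

text \<open>Commutators are even, which gives one inclusion. For the other, the alternating group is
  perfect when n is at least 5, and derived subgroups are monotone.\<close>

lemma derived_sym_group:
  assumes "5 \<le> n"
  shows "derived (sym_group n) (carrier (sym_group n)) = carrier (alt_group n)"
proof
  interpret S: group "sym_group n" by (rule sym_group_is_group)
  show "derived (sym_group n) (carrier (sym_group n)) \<subseteq> carrier (alt_group n)"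
    unfolding derived_def
  proof (rule S.generate_subgroup_incl[OF _ alt_group_is_subgroup], clarify)
    fix p q assume "p \<in> carrier (sym_group n)" "q \<in> carrier (sym_group n)"
    then show "p \<otimes>\<^bsub>sym_group n\<^esub> q \<otimes>\<^bsub>sym_group n\<^esub> inv\<^bsub>sym_group n\<^esub> p \<otimes>\<^bsub>sym_group n\<^esub> inv\<^bsub>sym_group n\<^esub> q
        \<in> carrier (alt_group n)"
      using sym_group_carrier'[of p n] sym_group_carrier'[of q n]
      by (auto simp: sym_group_mult alt_group_carrier sym_group_carrier permutes_compose permutes_inv
          evenperm_comp evenperm_inv permutation_compose permutation_inverse)
  qed
  have "alt_group n = (sym_group n)\<lparr>carrier := carrier (alt_group n)\<rparr>" by (simp add: alt_group_def)
  then have "carrier (alt_group n) = derived (sym_group n) (carrier (alt_group n))"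
    using derived_alt_group_const[OF assms] S.derived_consistent[OF _ alt_group_is_subgroup] by force
  also have "\<dots> \<subseteq> derived (sym_group n) (carrier (sym_group n))"
    using alt_group_is_subgroup[of n] by (intro S.mono_derived subgroup.subset order_refl)
  finally show "carrier (alt_group n) \<subseteq> derived (sym_group n) (carrier (sym_group n))" .
qed

theorem proposition7p2:
  shows "\<exists>G :: nat monoid. group G \<and> finite (carrier G) \<and>
    perfect_group (G\<lparr>carrier := derived G (carrier G)\<rparr>) \<and>
    G Mod derived G (carrier G) \<cong> integer_mod_group 2 \<and>
    (\<exists>s\<^sub>0. \<forall>s\<ge>s\<^sub>0. s \<ge> 1 \<longrightarrow> large_group (Pol s G))"
proof -
  let ?S = "sym_group 5" and ?A = "carrier (alt_group 5)"
  interpret S: group ?S by (rule sym_group_is_group)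
  have cardS: "card (carrier ?S) = 120" and cardA: "card ?A = 60"
    using alt_group_card_carrier[of 5] by (simp_all add: sym_group_card_carrier fact_numeral)
  then have finS: "finite (carrier ?S)" by (intro card_ge_0_finite) simp
  have AS: "?A \<subseteq> carrier ?S" by (auto simp: alt_group_carrier sym_group_carrier)
  \<comment> \<open>The elements of G have to be natural numbers, so the symmetric group is
    transported along an injection.\<close>
  obtain e :: "(nat \<Rightarrow> nat) \<Rightarrow> nat" where e: "inj_on e (carrier ?S)"
    using finite_imp_inj_to_nat_seg[OF finS] by blast
  define G where "G = image_group e ?S"
  have G: "group G" unfolding G_def by (rule S.inj_imp_image_group_is_group[OF e])
  interpret G: group G by fact
  have iso: "e \<in> iso ?S G" unfolding G_def by (rule inj_imp_image_group_iso[OF e])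
  interpret e: group_hom ?S G e
    using iso by unfold_locales (simp add: iso_def)
  have carrG: "carrier G = e ` carrier ?S" by (simp add: G_def image_group_carrier)
  have D: "derived G (carrier G) = e ` ?A"
    using e.derived_img[of "carrier ?S"] derived_sym_group[of 5] carrG by simp

  define j where "j = inv_into (carrier ?S) e"
  define \<epsilon> where "\<epsilon> x \<longleftrightarrow> \<not> evenperm (j x)" for x
  have j: "j (e p) = p" if "p \<in> carrier ?S" for p using that e by (simp add: j_def)
  have eps: "\<epsilon> \<in> hom G xor_group"
  proof -
    have "(\<lambda>p. \<not> evenperm p) \<in> hom ?S xor_group"
      using sym_group_carrier' by (intro homI) (auto simp: sym_group_mult evenperm_comp)
    then have "(\<lambda>p. \<not> evenperm p) \<circ> j \<in> hom G xor_group"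
      using S.iso_set_sym[OF iso] hom_compose unfolding j_def iso_def by blast
    then show ?thesis by (simp add: \<epsilon>_def[abs_def] comp_def)
  qed
  have odd: "{x \<in> carrier G. \<epsilon> x} = e ` (carrier ?S - ?A)"
    using j by (auto simp: carrG \<epsilon>_def alt_group_carrier sym_group_carrier)
  have even: "{x \<in> carrier G. \<not> \<epsilon> x} = e ` ?A"
    using j by (auto simp: carrG \<epsilon>_def alt_group_carrier sym_group_carrier)
  have card_odd: "card {x \<in> carrier G. \<epsilon> x} = 60"
    unfolding odd using AS finS cardS cardA
    by (subst card_image) (auto intro: inj_on_subset[OF e] simp: card_Diff_subset finite_subset)

  have "perfect_group (G\<lparr>carrier := derived G (carrier G)\<rparr>)"
  proof -
    have sub: "subgroup (derived G (carrier G)) G" by (intro G.derived_is_subgroup order_refl)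
    \<comment> \<open>Perfectness of the alternating group, computed inside the symmetric group so
      that \<open>e\<close> can carry it over.\<close>
    have "?A = derived ?S ?A"
      using derived_alt_group_const[of 5] S.derived_consistent[OF _ alt_group_is_subgroup[of 5]]
      by (simp add: alt_group_def)
    then have "derived G (derived G (carrier G)) = derived G (carrier G)"
      using e.derived_img[OF AS] by (simp add: D)
    then show ?thesis
      using G.derived_consistent[OF order_refl sub] G.subgroup_imp_group[OF sub]
      by (simp add: perfect_group_def)
  qed
  moreover have "G Mod derived G (carrier G) \<cong> integer_mod_group 2"
  proof -
    let ?h = "\<lambda>x. if \<epsilon> x then 1 else 0 :: int"
    interpret Z: group "integer_mod_group 2" by simp
    interpret h: group_hom G "integer_mod_group 2" ?h
      using hom_mult[OF eps] by unfold_locales (auto simp: carrier_integer_mod_group intro!: homI)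
    have "?h ` carrier G = carrier (integer_mod_group 2)"
    proof -
      have "{x \<in> carrier G. \<epsilon> x} \<noteq> {}" using card_odd card.empty by force
      then obtain x where "x \<in> carrier G" "\<epsilon> x" by blast
      moreover have "\<not> \<epsilon> \<one>\<^bsub>G\<^esub>" using hom_mult[OF eps G.one_closed G.one_closed] by simp
      ultimately have "{0, 1} \<subseteq> ?h ` carrier G"
        using imageI[of x "carrier G" ?h] imageI[OF G.one_closed, of ?h] by simp
      moreover have "?h ` carrier G \<subseteq> {0, 1}" by (rule image_subsetI) simp
      moreover have "carrier (integer_mod_group 2) = {0, 1}"
        by (auto simp: carrier_integer_mod_group)
      ultimately show ?thesis by (metis subset_antisym)
    qed
    \<comment> \<open>The kernel consists of the even elements, that is, of the image of the
      alternating group; the first isomorphism theorem then gives the quotient.\<close>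
    moreover have "kernel G (integer_mod_group 2) ?h = derived G (carrier G)"
      using even by (auto simp: kernel_def D)
    ultimately show ?thesis using h.FactGroup_iso by simp
  qed
  \<comment> \<open>The 60 odd elements exceed the 8 required, and 3 serves as the threshold for
    s.\<close>
  moreover have "large_group (Pol s G)" if "3 \<le> s" for s
    using large_group_Pol[OF G _ eps _ that] card_odd finS by (simp add: carrG)
  ultimately show ?thesis using G finS by (intro exI[of _ G]) (auto simp: carrG)
qed

end
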